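(* Let $k$ be a field and let $(\mathcal{A},m_\bullet,m_\circ)$ be an affine skew brace over $k$. For each $R\in\mathsf{Alg}_k$ and $a,b\in\mathcal{A}(R)$, define $$r_R(a,b)=\Big(\lambda_a(b),\ \lambda_{\lambda_a(b)}^{-1}\big((a\circ_R b)^{-1}\cdot_R a\cdot_R(a\circ_R b)\big)\Big),\qquad \lambda_a(b)=a^{-1}\cdot_R(a\circ_R b).$$ Then the family $\{r_R\}$ defines a natural transformation $r:\mathcal{A}\times\mathcal{A}\to\mathcal{A}\times\mathcal{A}$. Consequently, $(\mathcal{A},r)$ is a non-degenerate affine scheme solution to the Yang--Baxter equation. In particular, $(\mathcal{A},r)$ is involutive if and only if $\mathcal{A}$ is an affine brace.
   Context: All $k$-algebras are commutative and unital, with unital homomorphisms; $\mathsf{Alg}_k$ is their category. A skew brace is a triple $(A,\cdot,\circ)$ where $(A,\cdot)$ and $(A,\circ)$ are groups with $a\circ(b\cdot c)=(a\circ b)\cdot a^{-1}\cdot(a\circ c)$ for all $a,b,c$, where $a^{-1}$ always denotes the inverse in $(A,\cdot)$; it is a brace if $(A,\cdot)$ is abelian. In a skew brace each $\lambda_a$ is an automorphism of $(A,\cdot)$. An affine skew brace (resp. affine brace) over $k$ is a representable functor $\mathcal{A}:\mathsf{Alg}_k\to\mathsf{Set}$ with natural transformations $m_\bullet,m_\circ:\mathcal{A}\times\mathcal{A}\to\mathcal{A}$ such that, writing $a\cdot_R b=m_{\bullet R}(a,b)$ and $a\circ_R b=m_{\circ R}(a,b)$, $(\mathcal{A}(R),\cdot_R,\circ_R)$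 is a skew brace (resp. brace) for every $R\in\mathsf{Alg}_k$. A set-theoretical solution to the Yang--Baxter equation is a set $X$ with a bijection $r:X\times X\to X\times X$ satisfying $(r\times\operatorname{id})(\operatorname{id}\times r)(r\times\operatorname{id})=(\operatorname{id}\times r)(r\times\operatorname{id})(\operatorname{id}\times r)$. An affine scheme solution to the Yang--Baxter equation is a pair $(X,r)$ with $X:\mathsf{Alg}_k\to\mathsf{Set}$ a representable functor and $r:X\times X\to X\times X$ a natural transformation such that for every $R\in\mathsf{Alg}_k$ the map $r_R$, written $r_R(x,y)=(\sigma_{R,x}(y),\tau_{R,y}(x))$, is a set-theoretical solution on $X(R)$. It is non-degenerate if for every $R$ and $x\in X(R)$ the maps $\sigma_{R,x},\tau_{R,x}:X(R)\to X(R)$ are bijections, and involutive if $r\circ r=\operatorname{id}_{X\times X}$. *)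

theory Defs
  imports "HOL-Algebra.Module" "HOL-Library.FuncSet"
begin

section \<open>The category of commutative unital \<open>k\<close>-algebras and set-valued functors\<close>

text \<open>
  A commutative unital \<open>k\<close>-algebra is a record \<open>R\<close> with \<open>algebra k R\<close> (the library locale asks
  \<open>R\<close> to be a \<open>cring\<close>; the zero algebra is allowed). The type variable \<open>'u\<close> plays the role of the
  universe: the objects of the category are all \<open>k\<close>-algebras whose carrier is a subset of \<open>'u\<close>,
  and a representing algebra is an object of that same category. Nothing is assumed about \<open>'u\<close>.

  Homomorphisms are extensional on the carrier, so that equality of morphisms is HOL equality;
  identities and composites are \<open>restrict id\<close> and \<open>compose\<close>.
\<close>

definition alg_hom ::
  "('k, 'm) ring_scheme \<Rightarrow> ('k, 'u) module \<Rightarrow> ('k, 'u) module \<Rightarrow> ('u \<Rightarrow> 'u) set" where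
  "alg_hom k R S = {f \<in> ring_hom R S \<inter> extensional (carrier R).
     \<forall>c\<in>carrier k. \<forall>x\<in>carrier R. f (c \<odot>\<^bsub>R\<^esub> x) = c \<odot>\<^bsub>S\<^esub> f x}"

record ('k, 'u, 'x) alg_functor =
  fobj :: "('k, 'u) module \<Rightarrow> 'x set"
  fmor :: "('k, 'u) module \<Rightarrow> ('k, 'u) module \<Rightarrow> ('u \<Rightarrow> 'u) \<Rightarrow> 'x \<Rightarrow> 'x"

definition is_functor :: "('k, 'm) ring_scheme \<Rightarrow> ('k, 'u, 'x) alg_functor \<Rightarrow> bool" where
  "is_functor k F \<longleftrightarrow>
     (\<forall>R S. algebra k R \<longrightarrow> algebra k S \<longrightarrow>
        (\<forall>f\<in>alg_hom k R S. fmor F R S f \<in> fobj F R \<rightarrow> fobj F S)) \<and>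
     (\<forall>R. algebra k R \<longrightarrow> (\<forall>x\<in>fobj F R. fmor F R R (restrict id (carrier R)) x = x)) \<and>
     (\<forall>R S T. algebra k R \<longrightarrow> algebra k S \<longrightarrow> algebra k T \<longrightarrow>
        (\<forall>f\<in>alg_hom k R S. \<forall>g\<in>alg_hom k S T. \<forall>x\<in>fobj F R.
           fmor F R T (compose (carrier R) g f) x = fmor F S T g (fmor F R S f x)))"

text \<open>Only the values of a component \<open>\<eta> R\<close> on \<open>fobj F R\<close> for a \<open>k\<close>-algebra \<open>R\<close> matter.\<close>

definition natural_transformation ::
  "('k, 'm) ring_scheme \<Rightarrow> ('k, 'u, 'x) alg_functor \<Rightarrow> ('k, 'u, 'y) alg_functor \<Rightarrow>
     (('k, 'u) module \<Rightarrow> 'x \<Rightarrow> 'y) \<Rightarrow> bool" where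
  "natural_transformation k F G \<eta> \<longleftrightarrow>
     (\<forall>R. algebra k R \<longrightarrow> \<eta> R \<in> fobj F R \<rightarrow> fobj G R) \<and>
     (\<forall>R S. algebra k R \<longrightarrow> algebra k S \<longrightarrow>
        (\<forall>f\<in>alg_hom k R S. \<forall>x\<in>fobj F R.
           \<eta> S (fmor F R S f x) = fmor G R S f (\<eta> R x)))"

definition prod_functor ::
  "('k, 'u, 'x) alg_functor \<Rightarrow> ('k, 'u, 'y) alg_functor \<Rightarrow> ('k, 'u, 'x \<times> 'y) alg_functor" where
  "prod_functor F G = \<lparr>fobj = (\<lambda>R. fobj F R \<times> fobj G R),
     fmor = (\<lambda>R S f. map_prod (fmor F R S f) (fmor G R S f))\<rparr>"

definition hom_functor ::
  "('k, 'm) ring_scheme \<Rightarrow> ('k, 'u) module \<Rightarrow> ('k, 'u, 'u \<Rightarrow> 'u) alg_functor" where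
  "hom_functor k H = \<lparr>fobj = alg_hom k H, fmor = (\<lambda>R S f h. compose (carrier H) f h)\<rparr>"

definition representable :: "('k, 'm) ring_scheme \<Rightarrow> ('k, 'u, 'x) alg_functor \<Rightarrow> bool" where
  "representable k F \<longleftrightarrow> is_functor k F \<and>
     (\<exists>H \<phi>. algebra k H \<and> natural_transformation k (hom_functor k H) F \<phi> \<and>
        (\<forall>R. algebra k R \<longrightarrow> bij_betw (\<phi> R) (fobj (hom_functor k H) R) (fobj F R)))"

section \<open>Skew braces\<close>

text \<open>
  The structures here are bare binary operations on a set; \<open>op_monoid\<close> packages one as a library
  monoid record, whose unit is the two-sided neutral element (unspecified if there is none, in
  which case the record is not a group).
\<close>

definition op_monoid :: "'a set \<Rightarrow> ('a \<times> 'a \<Rightarrow> 'a) \<Rightarrow> 'a monoid" where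
  "op_monoid X f = \<lparr>carrier = X, mult = (\<lambda>x y. f (x, y)),
     one = (THE e. e \<in> X \<and> (\<forall>x\<in>X. f (e, x) = x \<and> f (x, e) = x))\<rparr>"

definition skew_brace :: "'a set \<Rightarrow> ('a \<times> 'a \<Rightarrow> 'a) \<Rightarrow> ('a \<times> 'a \<Rightarrow> 'a) \<Rightarrow> bool" where
  "skew_brace X d c \<longleftrightarrow> group (op_monoid X d) \<and> group (op_monoid X c) \<and>
     (\<forall>x\<in>X. \<forall>y\<in>X. \<forall>z\<in>X.
        c (x, d (y, z)) = d (d (c (x, y), inv\<^bsub>op_monoid X d\<^esub> x), c (x, z)))"

definition brace :: "'a set \<Rightarrow> ('a \<times> 'a \<Rightarrow> 'a) \<Rightarrow> ('a \<times> 'a \<Rightarrow> 'a) \<Rightarrow> bool" where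
  "brace X d c \<longleftrightarrow> skew_brace X d c \<and> comm_group (op_monoid X d)"

definition brace_lambda ::
  "'a set \<Rightarrow> ('a \<times> 'a \<Rightarrow> 'a) \<Rightarrow> ('a \<times> 'a \<Rightarrow> 'a) \<Rightarrow> 'a \<Rightarrow> 'a \<Rightarrow> 'a" where
  "brace_lambda X d c a b = d (inv\<^bsub>op_monoid X d\<^esub> a, c (a, b))"

text \<open>In a skew brace every \<open>\<lambda>\<^sub>a\<close> is a bijection of \<open>X\<close>, so \<open>inv_into X\<close> is its inverse.\<close>

definition brace_r ::
  "'a set \<Rightarrow> ('a \<times> 'a \<Rightarrow> 'a) \<Rightarrow> ('a \<times> 'a \<Rightarrow> 'a) \<Rightarrow> 'a \<times> 'a \<Rightarrow> 'a \<times> 'a" where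
  "brace_r X d c = (\<lambda>(a, b).
     (brace_lambda X d c a b,
      inv_into X (brace_lambda X d c (brace_lambda X d c a b))
        (d (d (inv\<^bsub>op_monoid X d\<^esub> (c (a, b)), a), c (a, b)))))"

definition affine_skew_brace ::
  "('k, 'm) ring_scheme \<Rightarrow> ('k, 'u, 'x) alg_functor \<Rightarrow>
     (('k, 'u) module \<Rightarrow> 'x \<times> 'x \<Rightarrow> 'x) \<Rightarrow> (('k, 'u) module \<Rightarrow> 'x \<times> 'x \<Rightarrow> 'x) \<Rightarrow> bool" where
  "affine_skew_brace k A d c \<longleftrightarrow> representable k A \<and>
     natural_transformation k (prod_functor A A) A d \<and>
     natural_transformation k (prod_functor A A) A c \<and>
     (\<forall>R. algebra k R \<longrightarrow> skew_brace (fobj A R) (d R) (c R))"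

definition affine_brace ::
  "('k, 'm) ring_scheme \<Rightarrow> ('k, 'u, 'x) alg_functor \<Rightarrow>
     (('k, 'u) module \<Rightarrow> 'x \<times> 'x \<Rightarrow> 'x) \<Rightarrow> (('k, 'u) module \<Rightarrow> 'x \<times> 'x \<Rightarrow> 'x) \<Rightarrow> bool" where
  "affine_brace k A d c \<longleftrightarrow> representable k A \<and>
     natural_transformation k (prod_functor A A) A d \<and>
     natural_transformation k (prod_functor A A) A c \<and>
     (\<forall>R. algebra k R \<longrightarrow> brace (fobj A R) (d R) (c R))"

definition affine_brace_r ::
  "('k, 'u, 'x) alg_functor \<Rightarrow>
     (('k, 'u) module \<Rightarrow> 'x \<times> 'x \<Rightarrow> 'x) \<Rightarrow> (('k, 'u) module \<Rightarrow> 'x \<times> 'x \<Rightarrow> 'x) \<Rightarrow>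
     ('k, 'u) module \<Rightarrow> 'x \<times> 'x \<Rightarrow> 'x \<times> 'x" where
  "affine_brace_r A d c = (\<lambda>R. brace_r (fobj A R) (d R) (c R))"

section \<open>Solutions to the Yang--Baxter equation\<close>

definition r_times_id :: "('a \<times> 'a \<Rightarrow> 'a \<times> 'a) \<Rightarrow> 'a \<times> 'a \<times> 'a \<Rightarrow> 'a \<times> 'a \<times> 'a" where
  "r_times_id r = (\<lambda>(x, y, z). (fst (r (x, y)), snd (r (x, y)), z))"

definition id_times_r :: "('a \<times> 'a \<Rightarrow> 'a \<times> 'a) \<Rightarrow> 'a \<times> 'a \<times> 'a \<Rightarrow> 'a \<times> 'a \<times> 'a" where
  "id_times_r r = (\<lambda>(x, y, z). (x, r (y, z)))"

definition ybe_solution :: "'a set \<Rightarrow> ('a \<times> 'a \<Rightarrow> 'a \<times> 'a) \<Rightarrow> bool" where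
  "ybe_solution X r \<longleftrightarrow> bij_betw r (X \<times> X) (X \<times> X) \<and>
     (\<forall>t \<in> X \<times> X \<times> X.
        (r_times_id r \<circ> id_times_r r \<circ> r_times_id r) t =
        (id_times_r r \<circ> r_times_id r \<circ> id_times_r r) t)"

definition affine_scheme_solution ::
  "('k, 'm) ring_scheme \<Rightarrow> ('k, 'u, 'x) alg_functor \<Rightarrow>
     (('k, 'u) module \<Rightarrow> 'x \<times> 'x \<Rightarrow> 'x \<times> 'x) \<Rightarrow> bool" where
  "affine_scheme_solution k X r \<longleftrightarrow> representable k X \<and>
     natural_transformation k (prod_functor X X) (prod_functor X X) r \<and>
     (\<forall>R. algebra k R \<longrightarrow> ybe_solution (fobj X R) (r R))"

text \<open>With \<open>r (x, y) = (\<sigma>\<^sub>x y, \<tau>\<^sub>y x)\<close>, the map \<open>\<tau>\<^sub>x\<close> is \<open>\<lambda>y. snd (r (y, x))\<close>.\<close>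

definition nondegenerate ::
  "('k, 'm) ring_scheme \<Rightarrow> ('k, 'u, 'x) alg_functor \<Rightarrow>
     (('k, 'u) module \<Rightarrow> 'x \<times> 'x \<Rightarrow> 'x \<times> 'x) \<Rightarrow> bool" where
  "nondegenerate k X r \<longleftrightarrow>
     (\<forall>R. algebra k R \<longrightarrow> (\<forall>x\<in>fobj X R.
        bij_betw (\<lambda>y. fst (r R (x, y))) (fobj X R) (fobj X R) \<and>
        bij_betw (\<lambda>y. snd (r R (y, x))) (fobj X R) (fobj X R)))"

definition involutive ::
  "('k, 'm) ring_scheme \<Rightarrow> ('k, 'u, 'x) alg_functor \<Rightarrow>
     (('k, 'u) module \<Rightarrow> 'x \<times> 'x \<Rightarrow> 'x \<times> 'x) \<Rightarrow> bool" where
  "involutive k X r \<longleftrightarrow>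
     (\<forall>R. algebra k R \<longrightarrow> (\<forall>p \<in> fobj X R \<times> fobj X R. (r R \<circ> r R) p = p))"

end

theory Submission
  imports Defs
begin

text \<open>
  Write \<open>u = \<lambda>\<^sub>a(b)\<close> and \<open>r(a, b) = (u, v)\<close>. The definition of \<open>v\<close> amounts to \<open>u \<circ> v = a \<circ> b\<close>, so
  \<open>v = u' \<circ> a \<circ> b\<close> with \<open>u'\<close> the inverse of \<open>u\<close> in \<open>(A, \<circ>)\<close>. In this form \<open>r\<close> is natural, being
  built from the group operations; \<open>\<lambda>\<close> is a left action of \<open>(A, \<circ>)\<close> on \<open>A\<close> and \<open>\<tau>\<close> a right one.
  Hence both sides of the Yang--Baxter equation agree in their outer entries, and then also in the
  middle one because \<open>r\<close> preserves the product \<open>\<circ>\<close>. Finally \<open>r\<^sup>2(a, b) = (a, b)\<close> iff \<open>a\<close> commutes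
  with \<open>a \<circ> b\<close> in \<open>(A, \<cdot>)\<close>, and \<open>a \<circ> b\<close> runs through all of \<open>A\<close>.
\<close>

section \<open>A skew brace as two group structures on one carrier\<close>

locale skew_brace_pair = G: group G + H: group H
  for G (structure) and H +
  assumes carrier_eq: "carrier H = carrier G"
    and brace_law: "\<lbrakk>x \<in> carrier G; y \<in> carrier G; z \<in> carrier G\<rbrakk> \<Longrightarrow>
      x \<otimes>\<^bsub>H\<^esub> (y \<otimes> z) = (x \<otimes>\<^bsub>H\<^esub> y) \<otimes> inv x \<otimes> (x \<otimes>\<^bsub>H\<^esub> z)"
begin

abbreviation circ (infixl "\<star>" 70) where "x \<star> y \<equiv> x \<otimes>\<^bsub>H\<^esub> y"

text \<open>Facts on \<open>H\<close> are restated over \<open>carrier G\<close>, so that all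
  membership goals have one form.\<close>

lemmas circ_closed [simp] = H.m_closed[unfolded carrier_eq]
  and circ_inv_closed [simp] = H.inv_closed[unfolded carrier_eq]
  and circ_one_closed [simp] = H.one_closed[unfolded carrier_eq]
  and circ_assoc = H.m_assoc[unfolded carrier_eq]
  and circ_l_one [simp] = H.l_one[unfolded carrier_eq]
  and circ_r_one [simp] = H.r_one[unfolded carrier_eq]
  and circ_l_inv [simp] = H.l_inv[unfolded carrier_eq]
  and circ_r_inv [simp] = H.r_inv[unfolded carrier_eq]
  and circ_l_cancel = H.Units_l_cancel[unfolded H.Units_eq, unfolded carrier_eq]
  and circ_inv_mult = H.inv_mult_group[unfolded carrier_eq]

lemma circ_inv_cancel [simp]:
  assumes "x \<in> carrier G" "y \<in> carrier G"
  shows "x \<star> (inv\<^bsub>H\<^esub> x \<star> y) = y" "inv\<^bsub>H\<^esub> x \<star> (x \<star> y) = y"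
  using assms by (simp_all flip: circ_assoc)

lemma dot_inv_cancel [simp]:
  assumes "x \<in> carrier G" "y \<in> carrier G"
  shows "x \<otimes> (inv x \<otimes> y) = y" "inv x \<otimes> (x \<otimes> y) = y"
  using assms by (simp_all flip: G.m_assoc)

section \<open>The two actions \<open>lam\<close> and \<open>tau\<close>\<close>

definition lam where "lam x y = inv x \<otimes> (x \<star> y)"

definition tau where "tau y x = inv\<^bsub>H\<^esub> (lam x y) \<star> (x \<star> y)"

definition rmap where "rmap = (\<lambda>(x, y). (lam x y, tau y x))"

lemma lam_closed [simp]:
  "\<lbrakk>x \<in> carrier G; y \<in> carrier G\<rbrakk> \<Longrightarrow> lam x y \<in> carrier G"
  by (simp add: lam_def)

lemma tau_closed [simp]:
  "\<lbrakk>x \<in> carrier G; y \<in> carrier G\<rbrakk> \<Longrightarrow> tau y x \<in> carrier G"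
  by (simp add: tau_def)

lemma circ_eq_dot_lam:
  "\<lbrakk>x \<in> carrier G; y \<in> carrier G\<rbrakk> \<Longrightarrow> x \<star> y = x \<otimes> lam x y"
  by (simp add: lam_def)

lemma lam_circ_tau [simp]:
  "\<lbrakk>x \<in> carrier G; y \<in> carrier G\<rbrakk> \<Longrightarrow> lam x y \<star> tau y x = x \<star> y"
  by (simp add: tau_def)

lemma lam_dot:
  assumes "x \<in> carrier G" "y \<in> carrier G" "z \<in> carrier G"
  shows "lam x (y \<otimes> z) = lam x y \<otimes> lam x z"
  using assms by (simp add: lam_def brace_law G.m_assoc)

text \<open>Expanding \<open>x \<star> y \<star> z\<close> in both bracketings by
  \<open>circ_eq_dot_lam\<close> shows that the two sides agree after left multiplication by
  \<open>x \<star> y\<close> in \<open>G\<close>.\<close>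

lemma lam_circ:
  assumes "x \<in> carrier G" "y \<in> carrier G" "z \<in> carrier G"
  shows "lam (x \<star> y) z = lam x (lam y z)"
proof -
  have "(x \<star> y) \<otimes> lam (x \<star> y) z = x \<star> (y \<star> z)"
    using assms by (simp add: circ_assoc flip: circ_eq_dot_lam)
  also have "\<dots> = x \<otimes> lam x (y \<otimes> lam y z)"
    using assms by (simp flip: circ_eq_dot_lam)
  also have "\<dots> = x \<otimes> lam x y \<otimes> lam x (lam y z)"
    using assms by (simp add: lam_dot G.m_assoc)
  also have "\<dots> = (x \<star> y) \<otimes> lam x (lam y z)"
    using assms by (simp flip: circ_eq_dot_lam)
  finally show ?thesis
    using assms by (simp add: G.Units_l_cancel)
qed

text \<open>The brace law at three units makes \<open>\<one> \<star> \<one>\<close> idempotent in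
  \<open>G\<close>, hence equal to \<open>\<one>\<close>; so \<open>\<one>\<close> is idempotent in
  \<open>H\<close> as well.\<close>

lemma ones_eq: "\<one>\<^bsub>H\<^esub> = \<one>"
proof -
  have "\<one> \<star> \<one> = (\<one> \<star> \<one>) \<otimes> (\<one> \<star> \<one>)"
    using brace_law[of \<one> \<one> \<one>] by simp
  then have "\<one> \<star> \<one> = \<one>"
    using G.l_cancel_one' by simp
  then show ?thesis
    by (metis G.one_closed H.l_cancel_one carrier_eq)
qed

lemma lam_one [simp]: "x \<in> carrier G \<Longrightarrow> lam \<one>\<^bsub>H\<^esub> x = x"
  unfolding lam_def by (simp add: ones_eq circ_l_one[unfolded ones_eq])

lemma lam_bij:
  assumes "x \<in> carrier G"
  shows "bij_betw (lam x) (carrier G) (carrier G)"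
  using assms
  by (intro bij_betw_byWitness[where f' = "lam (inv\<^bsub>H\<^esub> x)"]) (auto simp flip: lam_circ)

text \<open>Writing both circle products as dot products, each side becomes
  \<open>lam x y \<otimes> lam (x \<star> y) z\<close>, by \<open>lam_circ\<close> and
  \<open>lam_circ_tau\<close>.\<close>

lemma lam_circ_right:
  assumes "x \<in> carrier G" "y \<in> carrier G" "z \<in> carrier G"
  shows "lam x (y \<star> z) = lam x y \<star> lam (tau y x) z"
  using assms
  by (simp add: circ_eq_dot_lam[of y z] circ_eq_dot_lam[of "lam x y" "lam (tau y x) z"]
      lam_dot flip: lam_circ)

text \<open>By \<open>lam_circ_right\<close>, the inverse of \<open>lam x (y \<star> z)\<close>
  splits into two factors; the one from \<open>lam x y\<close> turns \<open>x \<star> y\<close> into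
  \<open>tau y x\<close>.\<close>

lemma tau_circ:
  assumes "x \<in> carrier G" "y \<in> carrier G" "z \<in> carrier G"
  shows "tau (y \<star> z) x = tau z (tau y x)"
  using assms by (simp add: tau_def[of "y \<star> z"] tau_def[of z] lam_circ_right circ_inv_mult)
    (simp add: tau_def circ_assoc)

lemma tau_one [simp]: "x \<in> carrier G \<Longrightarrow> tau \<one>\<^bsub>H\<^esub> x = x"
  by (simp add: tau_def lam_def) (simp flip: ones_eq)

lemma tau_bij:
  assumes "x \<in> carrier G"
  shows "bij_betw (tau x) (carrier G) (carrier G)"
  using assms
  by (intro bij_betw_byWitness[where f' = "tau (inv\<^bsub>H\<^esub> x)"]) (auto simp flip: tau_circ)

text \<open>Links \<open>tau\<close> to the conjugate that defines the second entry of
  \<open>brace_r\<close>; it also decides when \<open>rmap\<close> squares to the identity.\<close>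

lemma lam_tau:
  assumes "x \<in> carrier G" "y \<in> carrier G"
  shows "lam (lam x y) (tau y x) = inv (x \<star> y) \<otimes> x \<otimes> (x \<star> y)"
proof -
  have "lam (lam x y) (tau y x) = inv (lam x y) \<otimes> (x \<star> y)"
    using assms by (simp add: lam_def[of "lam x y"])
  also have "\<dots> = inv (x \<star> y) \<otimes> x \<otimes> (x \<star> y)"
    using assms by (simp add: lam_def G.inv_mult_group)
  finally show ?thesis .
qed

section \<open>Bijectivity, braid relation and involutivity of \<open>rmap\<close>\<close>

lemma rmap_closed: "rmap \<in> carrier G \<times> carrier G \<rightarrow> carrier G \<times> carrier G"
  by (auto simp: rmap_def)

text \<open>The first entry and the circle product determine the second entry, by cancellation in
  \<open>H\<close>.\<close>

lemma rmap_eqI: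
  assumes "x \<in> carrier G" "y \<in> carrier G" "u \<in> carrier G" "v \<in> carrier G"
    and "lam x y = u" "u \<star> v = x \<star> y"
  shows "rmap (x, y) = (u, v)"
  using assms by (auto simp: rmap_def tau_def simp flip: assms(6))

lemma rmap_bij: "bij_betw rmap (carrier G \<times> carrier G) (carrier G \<times> carrier G)"
proof -
  \<comment> \<open>Since \<open>u \<star> v = x \<star> y\<close> and
    \<open>u = inv x \<otimes> (x \<star> y)\<close>, the first argument must be
    \<open>(u \<star> v) \<otimes> inv u\<close>; the second follows from the circle
    product.\<close>
  define g where "g = (\<lambda>(u, v). let x = (u \<star> v) \<otimes> inv u in (x, inv\<^bsub>H\<^esub> x \<star> (u \<star> v)))"
  show ?thesis
  proof (intro bij_betw_byWitness[where f' = g] ballI)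
    fix p assume "p \<in> carrier G \<times> carrier G"
    then obtain x y where p: "p = (x, y)" "x \<in> carrier G" "y \<in> carrier G"
      by blast
    then have "(x \<star> y) \<otimes> inv (lam x y) = x"
      by (simp add: lam_def G.inv_mult_group)
    then show "g (rmap p) = p"
      using p by (simp add: g_def rmap_def)
  next
    fix p assume "p \<in> carrier G \<times> carrier G"
    then obtain u v where p: "p = (u, v)" "u \<in> carrier G" "v \<in> carrier G"
      by blast
    let ?x = "(u \<star> v) \<otimes> inv u"
    have "lam ?x (inv\<^bsub>H\<^esub> ?x \<star> (u \<star> v)) = u"
      using p by (simp add: lam_def G.inv_mult_group G.m_assoc)
    then show "rmap (g p) = p"
      using p by (simp add: g_def Let_def rmap_eqI)
  qed (auto simp: rmap_def g_def Let_def)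
qed

lemma rmap_yang_baxter:
  assumes "t \<in> carrier G \<times> carrier G \<times> carrier G"
  shows "(r_times_id rmap \<circ> id_times_r rmap \<circ> r_times_id rmap) t =
    (id_times_r rmap \<circ> r_times_id rmap \<circ> id_times_r rmap) t"
proof -
  obtain x y z where t: "t = (x, y, z)"
    and cl: "x \<in> carrier G" "y \<in> carrier G" "z \<in> carrier G"
    using assms by blast
  \<comment> \<open>\<open>?a\<close> and \<open>?b\<close> are the common outer entries;
    \<open>?m\<close> and \<open>?n\<close> are the middle entries of the left and right
    sides.\<close>
  let ?a = "lam x (lam y z)" and ?b = "tau z (tau y x)"
  let ?m = "tau (lam (tau y x) z) (lam x y)" and ?n = "lam (tau (lam y z) x) (tau z y)"
  have first: "lam (lam x y) (lam (tau y x) z) = ?a"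
    using cl by (simp flip: lam_circ)
  have last: "tau (tau z y) (tau (lam y z) x) = ?b"
    using cl by (simp flip: tau_circ)
  have yz: "x \<star> lam y z \<star> tau z y = x \<star> y \<star> z"
    using cl by (simp add: circ_assoc)
  \<comment> \<open>Rewriting \<open>?a\<close> back through \<open>first\<close> pairs it with
    \<open>?m\<close>, so that \<open>lam_circ_tau\<close> collapses their product.\<close>
  have "?a \<star> ?m \<star> ?b = x \<star> y \<star> z"
    using cl by (simp add: circ_assoc flip: first) (simp flip: circ_assoc)
  moreover have "?a \<star> ?n \<star> ?b = x \<star> y \<star> z"
    using cl by (simp add: circ_assoc flip: last) (simp add: yz flip: circ_assoc)
  ultimately have "?a \<star> (?m \<star> ?b) = ?a \<star> (?n \<star> ?b)"
    using cl by (simp add: circ_assoc)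
  then have "?m = ?n"
    using cl by (simp add: circ_l_cancel H.right_cancel[unfolded carrier_eq])
  then show ?thesis
    by (simp add: t r_times_id_def id_times_r_def rmap_def first last)
qed

lemma rmap_square_eq_iff:
  assumes "x \<in> carrier G" "y \<in> carrier G"
  shows "rmap (rmap (x, y)) = (x, y) \<longleftrightarrow> x \<otimes> (x \<star> y) = (x \<star> y) \<otimes> x"
proof -
  let ?u = "lam x y" and ?v = "tau y x"
  \<comment> \<open>Only first entries need comparing, because
    \<open>?u \<star> ?v = x \<star> y\<close>.\<close>
  have "rmap (rmap (x, y)) = (x, y) \<longleftrightarrow> lam ?u ?v = x"
    using assms rmap_eqI[of ?u ?v x y] by (auto simp: rmap_def)
  also have "\<dots> \<longleftrightarrow> inv (x \<star> y) \<otimes> (x \<otimes> (x \<star> y)) = x"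
    using assms by (simp add: lam_tau G.m_assoc)
  also have "\<dots> \<longleftrightarrow> x \<otimes> (x \<star> y) = (x \<star> y) \<otimes> x"
    using assms by (metis G.inv_solve_left G.m_closed circ_closed)
  finally show ?thesis .
qed

lemma rmap_involutive_iff:
  "(\<forall>p \<in> carrier G \<times> carrier G. rmap (rmap p) = p) \<longleftrightarrow> comm_group G"
proof
  assume inv: "\<forall>p \<in> carrier G \<times> carrier G. rmap (rmap p) = p"
  show "comm_group G"
  proof (rule G.group_comm_groupI)
    fix x y assume "x \<in> carrier G" "y \<in> carrier G"
    then show "x \<otimes> y = y \<otimes> x"
      \<comment> \<open>This second argument makes the circle product with \<open>x\<close> equal to
        \<open>y\<close>.\<close>
      using inv rmap_square_eq_iff[of x "inv\<^bsub>H\<^esub> x \<star> y"] by simp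
  qed
next
  assume "comm_group G"
  then interpret comm_group G .
  show "\<forall>p \<in> carrier G \<times> carrier G. rmap (rmap p) = p"
    by (auto simp: rmap_square_eq_iff m_comm)
qed

end

text \<open>This yields naturality, with \<open>f\<close> the map that the functor assigns to an
  algebra homomorphism.\<close>

lemma skew_brace_pair_rmap_hom:
  assumes "skew_brace_pair G H" "skew_brace_pair G' H'"
    and f: "f \<in> hom G G'" "f \<in> hom H H'"
    and xy: "x \<in> carrier G" "y \<in> carrier G"
  shows "skew_brace_pair.rmap G' H' (f x, f y) =
    map_prod f f (skew_brace_pair.rmap G H (x, y))"
proof -
  interpret S: skew_brace_pair G H by fact
  interpret S': skew_brace_pair G' H' by fact
  interpret fG: group_hom G G' f by unfold_locales (rule f(1))
  interpret fH: group_hom H H' f by unfold_locales (rule f(2))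
  note hom_simps = fH.hom_mult[unfolded S.carrier_eq] fH.hom_inv[unfolded S.carrier_eq]
  have "S'.lam (f x) (f y) = f (S.lam x y)"
    using xy by (simp add: S.lam_def S'.lam_def hom_simps)
  then show ?thesis
    using xy by (simp add: S.rmap_def S'.rmap_def S.tau_def S'.tau_def hom_simps)
qed

section \<open>Transfer to \<open>brace_r\<close> on a bare set\<close>

lemma op_monoid_simps [simp]:
  "carrier (op_monoid X f) = X"
  "x \<otimes>\<^bsub>op_monoid X f\<^esub> y = f (x, y)"
  by (simp_all add: op_monoid_def)

lemma skew_brace_iff_pair:
  "skew_brace X d c \<longleftrightarrow> skew_brace_pair (op_monoid X d) (op_monoid X c)"
  by (auto simp: skew_brace_def skew_brace_pair_def skew_brace_pair_axioms_def)

lemma brace_r_eq_rmap: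
  assumes "skew_brace X d c" and "p \<in> X \<times> X"
  shows "brace_r X d c p = skew_brace_pair.rmap (op_monoid X d) (op_monoid X c) p"
proof -
  interpret skew_brace_pair "op_monoid X d" "op_monoid X c"
    using assms(1) by (simp add: skew_brace_iff_pair)
  obtain a b where p: "p = (a, b)" "a \<in> X" "b \<in> X"
    using assms(2) by blast
  have lam: "brace_lambda X d c = lam"
    by (intro ext) (simp add: brace_lambda_def lam_def)
  \<comment> \<open>By \<open>lam_tau\<close> the conjugate in \<open>brace_r\<close> is this image
    of \<open>tau b a\<close>, so injectivity of \<open>lam\<close> recovers
    \<open>tau b a\<close>.\<close>
  have "inv_into X (lam (lam a b)) (lam (lam a b) (tau b a)) = tau b a"
    using p lam_bij[of "lam a b"] lam_closed[of a b] tau_closed[of a b]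
    by (intro inv_into_f_f) (simp_all add: bij_betw_def)
  then show ?thesis
    using p lam_tau[of a b] by (simp add: brace_r_def rmap_def lam)
qed

lemma skew_brace_ybe_solution:
  assumes "skew_brace X d c"
  shows "ybe_solution X (brace_r X d c)"
proof -
  interpret skew_brace_pair "op_monoid X d" "op_monoid X c"
    using assms by (simp add: skew_brace_iff_pair)
  note r = brace_r_eq_rmap[OF assms]
  have bij: "bij_betw (brace_r X d c) (X \<times> X) (X \<times> X)"
    using rmap_bij bij_betw_cong[of "X \<times> X" "brace_r X d c" rmap] r by simp
  \<comment> \<open>\<open>brace_r\<close> is known to agree with \<open>rmap\<close> only on
    \<open>X \<times> X\<close>, so each intermediate triple must be kept inside
    \<open>X\<close>.\<close>
  have cl: "fst (rmap p) \<in> X" "snd (rmap p) \<in> X" if "p \<in> X \<times> X" for p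
    using funcset_mem[OF rmap_closed, of p] that by (simp_all add: mem_Times_iff)
  have 1: "r_times_id (brace_r X d c) t = r_times_id rmap t"
      "r_times_id rmap t \<in> X \<times> X \<times> X" if "t \<in> X \<times> X \<times> X" for t
    using that by (auto simp: r_times_id_def r cl)
  have 2: "id_times_r (brace_r X d c) t = id_times_r rmap t"
      "id_times_r rmap t \<in> X \<times> X \<times> X" if "t \<in> X \<times> X \<times> X" for t
    using that by (cases t; auto simp: id_times_r_def r cl mem_Times_iff)+
  show ?thesis
    using bij rmap_yang_baxter by (simp add: ybe_solution_def 1 2)
qed

lemma skew_brace_nondegenerate:
  assumes "skew_brace X d c" and "x \<in> X"
  shows "bij_betw (\<lambda>y. fst (brace_r X d c (x, y))) X X"
    and "bij_betw (\<lambda>y. snd (brace_r X d c (y, x))) X X"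
proof -
  interpret skew_brace_pair "op_monoid X d" "op_monoid X c"
    using assms(1) by (simp add: skew_brace_iff_pair)
  show "bij_betw (\<lambda>y. fst (brace_r X d c (x, y))) X X"
    using lam_bij[of x] assms bij_betw_cong[of X "\<lambda>y. fst (brace_r X d c (x, y))" "lam x"]
    by (simp add: brace_r_eq_rmap rmap_def)
  show "bij_betw (\<lambda>y. snd (brace_r X d c (y, x))) X X"
    using tau_bij[of x] assms bij_betw_cong[of X "\<lambda>y. snd (brace_r X d c (y, x))" "tau x"]
    by (simp add: brace_r_eq_rmap rmap_def)
qed

lemma skew_brace_involutive_iff:
  assumes "skew_brace X d c"
  shows "(\<forall>p \<in> X \<times> X. (brace_r X d c \<circ> brace_r X d c) p = p) \<longleftrightarrow> brace X d c"
proof -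
  interpret skew_brace_pair "op_monoid X d" "op_monoid X c"
    using assms by (simp add: skew_brace_iff_pair)
  have "rmap p \<in> X \<times> X" if "p \<in> X \<times> X" for p
    using rmap_closed that by auto
  then show ?thesis
    using rmap_involutive_iff assms by (simp add: brace_def brace_r_eq_rmap)
qed

section \<open>Passage to functors\<close>

lemma affine_skew_brace_r_natural:
  fixes A :: "('k, 'u, 'x) alg_functor"
  assumes "affine_skew_brace k A d c"
  shows "natural_transformation k (prod_functor A A) (prod_functor A A) (affine_brace_r A d c)"
  unfolding natural_transformation_def
proof (intro conjI allI impI ballI)
  fix R :: "('k, 'u) module" assume R: "algebra k R"
  then have "ybe_solution (fobj A R) (brace_r (fobj A R) (d R) (c R))"
    using assms by (simp add: affine_skew_brace_def skew_brace_ybe_solution)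
  then show "affine_brace_r A d c R \<in> fobj (prod_functor A A) R \<rightarrow> fobj (prod_functor A A) R"
    by (simp add: ybe_solution_def prod_functor_def affine_brace_r_def bij_betw_imp_funcset)
next
  fix R S :: "('k, 'u) module" and f p
  assume RS: "algebra k R" "algebra k S" and f: "f \<in> alg_hom k R S"
    and "p \<in> fobj (prod_functor A A) R"
  then obtain x y where p: "p = (x, y)" "x \<in> fobj A R" "y \<in> fobj A R"
    by (auto simp: prod_functor_def)
  let ?F = "fmor A R S f"
  have F: "?F \<in> fobj A R \<rightarrow> fobj A S"
    using assms RS f by (simp add: affine_skew_brace_def representable_def is_functor_def)
  \<comment> \<open>Naturality of an operation says exactly that \<open>?F\<close> is multiplicative
    for it; a generic \<open>e\<close> serves both \<open>d\<close> and \<open>c\<close>.\<close>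
  have hom: "?F \<in> hom (op_monoid (fobj A R) (e R)) (op_monoid (fobj A S) (e S))"
    if "natural_transformation k (prod_functor A A) A e" for e
  proof -
    have "\<forall>q \<in> fobj A R \<times> fobj A R. e S (map_prod ?F ?F q) = ?F (e R q)"
      using that RS f by (simp add: natural_transformation_def prod_functor_def)
    then show ?thesis
      using F by (auto simp: hom_def)
  qed
  have sb: "skew_brace (fobj A R) (d R) (c R)" "skew_brace (fobj A S) (d S) (c S)"
    using assms RS by (simp_all add: affine_skew_brace_def)
  have "skew_brace_pair.rmap (op_monoid (fobj A S) (d S)) (op_monoid (fobj A S) (c S)) (?F x, ?F y) =
    map_prod ?F ?F
      (skew_brace_pair.rmap (op_monoid (fobj A R) (d R)) (op_monoid (fobj A R) (c R)) (x, y))"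
    using p sb assms
    by (intro skew_brace_pair_rmap_hom)
      (simp_all add: hom affine_skew_brace_def flip: skew_brace_iff_pair)
  moreover have "?F x \<in> fobj A S" "?F y \<in> fobj A S"
    using F p by auto
  ultimately show "affine_brace_r A d c S (fmor (prod_functor A A) R S f p) =
      fmor (prod_functor A A) R S f (affine_brace_r A d c R p)"
    using p sb by (simp add: affine_brace_r_def prod_functor_def brace_r_eq_rmap)
qed

theorem proposition6p3:
  fixes k :: "('k, 'm) ring_scheme"
    and A :: "('k, 'u, 'x) alg_functor"
    and d c :: "('k, 'u) module \<Rightarrow> 'x \<times> 'x \<Rightarrow> 'x"
  assumes "field k"
    and "affine_skew_brace k A d c"
  shows "natural_transformation k (prod_functor A A) (prod_functor A A) (affine_brace_r A d c) \<and>
    affine_scheme_solution k A (affine_brace_r A d c) \<and>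
    nondegenerate k A (affine_brace_r A d c) \<and>
    (involutive k A (affine_brace_r A d c) \<longleftrightarrow> affine_brace k A d c)"
proof -
  have sb: "skew_brace (fobj A R) (d R) (c R)" if "algebra k R" for R
    using assms(2) that by (simp add: affine_skew_brace_def)
  note nat = affine_skew_brace_r_natural[OF assms(2)]
  have "affine_scheme_solution k A (affine_brace_r A d c)"
    using assms(2) nat skew_brace_ybe_solution[OF sb]
    by (simp add: affine_scheme_solution_def affine_skew_brace_def affine_brace_r_def)
  moreover have "nondegenerate k A (affine_brace_r A d c)"
    using skew_brace_nondegenerate[OF sb] by (simp add: nondegenerate_def affine_brace_r_def)
  \<comment> \<open>Both properties are tested algebra by algebra, so the equivalence for single
    skew braces suffices.\<close>
  moreover have "involutive k A (affine_brace_r A d c) \<longleftrightarrow> affine_brace k A d c"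
    using assms(2) skew_brace_involutive_iff[OF sb]
    by (simp add: involutive_def affine_brace_def affine_skew_brace_def affine_brace_r_def)
  ultimately show ?thesis
    using nat by blast
qed

end
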